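(* For every integer $n\geqslant 0$, $$Q_0(n) = \sum_{k=0}^\infty pod\left(\frac{n-k(k+1)/2}{2} \right).$$
   Context: A partition of $n$ is a nonincreasing sequence of positive integers (called parts) with sum $n$; the empty partition is the only partition of $0$. $Q_0(n)$ is the number of partitions of $n$ into distinct parts none of which is congruent to $0$ modulo $4$. $pod(n)$ is the number of partitions of $n$ in which odd parts are distinct and even parts are unrestricted; $pod(0)=1$ and $pod(x)=0$ if $x$ is not a nonnegative integer (so the sum is finite). *)

theory Defs
  imports Complex_Main
begin

definition partitions :: "nat \<Rightarrow> nat list set" where
  "partitions n = {xs. sorted_wrt (\<ge>) xs \<and> (\<forall>x\<in>set xs. 0 < x) \<and> sum_list xs = n}"

definition Q0 :: "nat \<Rightarrow> nat" where
  "Q0 n = card {xs \<in> partitions n. distinct xs \<and> (\<forall>x\<in>set xs. x mod 4 \<noteq> 0)}"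

(* Only the odd parts have to be pairwise distinct; even parts may repeat. *)
definition pod_nat :: "nat \<Rightarrow> nat" where
  "pod_nat n = card {xs \<in> partitions n. distinct (filter odd xs)}"

(* Extension by 0 to arguments that are not nonnegative integers. *)
definition pod :: "rat \<Rightarrow> nat" where
  "pod x = (if x \<in> \<nat> then pod_nat (nat \<lfloor>x\<rfloor>) else 0)"

end

theory Submission
  imports Defs "HOL-Computational_Algebra.Formal_Laurent_Series"
begin

text \<open>
  Write \<open>\<psi>(q) = \<Sum>\<^sub>k q^(k(k+1)/2)\<close>. The right-hand side of the theorem is the coefficient of \<open>q^n\<close>
  in \<open>\<psi>(q) G(q^2)\<close>, where \<open>G\<close> is the generating function of \<open>pod\<close>. With products over all
  \<open>i \<ge> 0\<close>,

    \<open>\<Sum>\<^sub>n Q0(n) q^n = \<Prod> (1 + q^(2i+1)) (1 + q^(4i+2))\<close>  and  \<open>G(q^2) = \<Prod> (1 + q^(4i+2)) / (1 - q^(4i+4))\<close>,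

  since the parts not divisible by 4 are the odd numbers and the numbers \<open>4i+2\<close>. The factors
  \<open>1 + q^(4i+2)\<close> are common to both sides, so the claim reduces to
  \<open>\<psi>(q) = \<Prod> (1 + q^(2i+1)) (1 - q^(4i+4))\<close>. Multiplying and dividing by \<open>1 - q^(2i+1)\<close> turns the
  product into \<open>\<Prod> (1 - q^(4i+2)) (1 - q^(4i+4)) / (1 - q^(2i+1))\<close>, that is, into
  \<open>\<Prod> (1 - q^(2i+2)) / (1 - q^(2i+1))\<close>, which is \<open>\<psi>(q)\<close> by a theorem of Gauss.

  Gauss's theorem is obtained from a finite identity of Shanks (\<open>shanks_identity\<close>), which is
  proved by telescoping: with \<open>P\<^sub>n = \<Prod>\<^sub>i\<^sub><\<^sub>n (1 - q^(2i+2)) / (1 - q^(2i+1))\<close>, the sum of the first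
  \<open>2n\<close> terms of \<open>\<psi>\<close> is \<open>\<Sum>\<^sub>s\<^sub><\<^sub>n (P\<^sub>n / P\<^sub>s) q^(s(2n+1))\<close>, in which only the term \<open>P\<^sub>n\<close> for
  \<open>s = 0\<close> is nonzero modulo \<open>q^(2n+1)\<close>.

  A single coefficient sees only finitely many factors, so no infinite product or limit occurs:
  all products are finite and the identities are congruences modulo \<open>q^(2N)\<close>, stated as
  divisibility (\<open>gauss_triangular_series_truncated\<close>, \<open>Q0_product_congruence\<close>). These hold in any
  commutative ring; reciprocals enter as elements \<open>u i\<close>, \<open>d i\<close> known to be inverse to
  \<open>1 - q^(2i+1)\<close>, \<open>1 - q^(4i+4)\<close>. Only the counting lemmas and the final extraction of
  coefficients use formal power series.
\<close>

section \<open>Generating functions of restricted partitions\<close>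

text \<open>
  The multiplicity of each part \<open>m\<close> is confined to a set \<open>S m\<close>. Distinctness is the choice
  \<open>S m = {0, 1}\<close>, and \<open>S m = UNIV\<close> puts no condition on \<open>m\<close>, so one counting lemma serves both
  \<open>Q0\<close> and \<open>pod_nat\<close>.
\<close>

definition restricted_partitions :: "nat set \<Rightarrow> (nat \<Rightarrow> nat set) \<Rightarrow> nat \<Rightarrow> nat list set" where
  "restricted_partitions A S n =
     {xs \<in> partitions n. set xs \<subseteq> A \<and> (\<forall>m\<in>A. count_list xs m \<in> S m)}"

text \<open>
  This is \<open>\<Sum>\<^sub>j q^(m j)\<close> over \<open>j \<in> T\<close>, the contribution of the part \<open>m\<close> when \<open>T\<close> is its set of allowed
  multiplicities.
\<close>

definition part_series :: "nat \<Rightarrow> nat set \<Rightarrow> int fps" where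
  "part_series m T = Abs_fps (\<lambda>i. of_bool (m dvd i \<and> i div m \<in> T))"

lemma decreasing_list_split_maximum:
  fixes xs :: "'a::linorder list"
  assumes "sorted_wrt (\<ge>) xs" "\<forall>x\<in>set xs. x \<le> b"
  shows "xs = replicate (count_list xs b) b @ filter (\<lambda>x. x \<noteq> b) xs"
  using assms
proof (induction xs)
  case (Cons x xs)
  show ?case
  proof (cases "x = b")
    case True
    then show ?thesis using Cons by simp
  next
    case False
    then have "b \<notin> set xs" using Cons.prems by force
    moreover from this have "filter (\<lambda>x. x \<noteq> b) xs = xs" by (intro filter_True) auto
    ultimately show ?thesis using False by simp
  qed
qed simp

lemma count_list_replicate_append:
  "count_list (replicate j b @ ys) m = (if m = b then j else 0) + count_list ys m"
  by (induction j) auto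

lemma count_list_filter: "count_list (filter P xs) x = (if P x then count_list xs x else 0)"
  by (induction xs) auto

text \<open>
  The copies of a part \<open>b\<close> exceeding all others form an initial segment of the decreasing list.
  The index \<open>i\<close> is the total \<open>j b\<close> of these copies rather than their number \<open>j\<close>, so that the
  union has the shape of a Cauchy product.
\<close>

lemma restricted_partitions_insert:
  assumes "0 < b" "\<forall>a\<in>A. a < b"
  shows "restricted_partitions (insert b A) S n =
     (\<Union>i\<in>{i. i \<le> n \<and> b dvd i \<and> i div b \<in> S b}.
        (\<lambda>ys. replicate (i div b) b @ ys) ` restricted_partitions A S (n - i))"
    (is "?L = ?R")
proof
  show "?L \<subseteq> ?R"
  proof
    fix xs assume xs: "xs \<in> ?L"
    define j where "j = count_list xs b"
    define ys where "ys = filter (\<lambda>x. x \<noteq> b) xs"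
    have sorted: "sorted_wrt (\<ge>) xs" and pos: "\<forall>x\<in>set xs. 0 < x" and sum: "sum_list xs = n"
      and sub: "set xs \<subseteq> insert b A" and cnt: "\<forall>m\<in>insert b A. count_list xs m \<in> S m"
      using xs by (auto simp: restricted_partitions_def partitions_def)
    have "\<forall>x\<in>set xs. x \<le> b" using sub assms(2) by force
    then have split: "xs = replicate j b @ ys"
      unfolding j_def ys_def using sorted by (intro decreasing_list_split_maximum)
    have total: "n = j * b + sum_list ys"
      using sum by (subst (asm) split) (simp add: sum_list_replicate)
    have "ys \<in> restricted_partitions A S (n - j * b)"
      using sorted pos sub cnt assms(2) total unfolding restricted_partitions_def partitions_def
      by (auto simp: ys_def sorted_wrt_filter count_list_filter)
    moreover have "j \<in> S b" using cnt by (simp add: j_def)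
    ultimately show "xs \<in> ?R"
      using split total assms(1) by (intro UN_I[of "j * b"]) auto
  qed
next
  show "?R \<subseteq> ?L"
  proof
    fix xs assume "xs \<in> ?R"
    then obtain i ys where i: "i \<le> n" "b dvd i" "i div b \<in> S b"
      and ys: "ys \<in> restricted_partitions A S (n - i)" and xs: "xs = replicate (i div b) b @ ys"
      by blast
    have ys': "sorted_wrt (\<ge>) ys" "\<forall>x\<in>set ys. 0 < x" "sum_list ys = n - i" "set ys \<subseteq> A"
        "\<forall>m\<in>A. count_list ys m \<in> S m"
      using ys by (auto simp: restricted_partitions_def partitions_def)
    have "b \<notin> set ys" using ys'(4) assms(2) by auto
    then have "\<forall>m\<in>insert b A. count_list xs m \<in> S m"
      unfolding xs count_list_replicate_append using ys'(5) i(3) assms(2) by (auto simp: count_notin)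
    moreover have "sorted_wrt (\<ge>) xs"
    proof -
      have "sorted_wrt (\<ge>) (replicate j b)" for j by (induction j) auto
      then show ?thesis
        unfolding xs sorted_wrt_append using ys'(1,4) assms(2) by force
    qed
    moreover have "sum_list xs = n" unfolding xs using ys'(3) i by (simp add: sum_list_replicate)
    ultimately show "xs \<in> ?L"
      using ys'(2,4) assms(1) unfolding restricted_partitions_def partitions_def xs by auto
  qed
qed

text \<open>
  By induction on the set of parts, adding the largest part last: splitting off its copies
  expresses the count as a convolution, which is multiplication of power series. Finiteness is
  carried along because the cardinality of an infinite set would be 0.
\<close>

lemma restricted_partitions_generating_function:
  assumes "finite A" "0 \<notin> A"
  shows "finite (restricted_partitions A S n) \<and>
    int (card (restricted_partitions A S n)) = (\<Prod>m\<in>A. part_series m (S m)) $ n"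
  using assms
proof (induction A arbitrary: n rule: finite_linorder_max_induct)
  case empty
  have "restricted_partitions {} S n = (if n = 0 then {[]} else {})"
    by (auto simp: restricted_partitions_def partitions_def)
  then show ?case by simp
next
  case (insert b A)
  define I where "I = {i. i \<le> n \<and> b dvd i \<and> i div b \<in> S b}"
  define B where "B i = (\<lambda>ys. replicate (i div b) b @ ys) ` restricted_partitions A S (n - i)" for i
  have IH: "finite (restricted_partitions A S k)"
    "int (card (restricted_partitions A S k)) = (\<Prod>m\<in>A. part_series m (S m)) $ k" for k
    using insert by auto
  have b: "0 < b" "b \<notin> A" using insert by auto
  have eq: "restricted_partitions (insert b A) S n = (\<Union>i\<in>I. B i)"
    unfolding I_def B_def using insert.hyps(2) b by (intro restricted_partitions_insert) auto
  have finI: "finite I" by (simp add: I_def)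
  have finB: "finite (B i)" for i using IH by (simp add: B_def)
  have cardB: "card (B i) = card (restricted_partitions A S (n - i))" for i
    unfolding B_def by (intro card_image inj_onI) simp
  have mult: "count_list xs b = i div b" if xs: "xs \<in> B i" for xs i
  proof -
    obtain ys where "xs = replicate (i div b) b @ ys" and ys: "ys \<in> restricted_partitions A S (n - i)"
      using xs unfolding B_def by blast
    moreover have "b \<notin> set ys" using b ys by (auto simp: restricted_partitions_def)
    ultimately show ?thesis by (simp only: count_list_replicate_append) (simp add: count_notin)
  qed
  \<comment> \<open>The multiplicity of \<open>b\<close> in a list recovers the index of its block.\<close>
  have "B i \<inter> B k = {}" if "i \<in> I" "k \<in> I" "i \<noteq> k" for i k
    using mult[of _ i] mult[of _ k] that by (fastforce simp: I_def)
  then have "card (\<Union>i\<in>I. B i) = (\<Sum>i\<in>I. card (B i))"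
    using finI finB by (intro card_UN_disjoint) auto
  then have "int (card (restricted_partitions (insert b A) S n)) =
     (\<Sum>i\<in>I. (\<Prod>m\<in>A. part_series m (S m)) $ (n - i))"
    by (simp add: eq cardB IH)
  also have "\<dots> = (\<Sum>i=0..n. part_series b (S b) $ i * (\<Prod>m\<in>A. part_series m (S m)) $ (n - i))"
    by (rule sum.mono_neutral_cong_left) (auto simp: I_def part_series_def)
  also have "\<dots> = (\<Prod>m\<in>insert b A. part_series m (S m)) $ n"
    using insert.hyps(1) b by (simp add: fps_mult_nth)
  finally show ?case using eq finI finB by simp
qed

lemma part_series_at_most_once:
  assumes "0 < m"
  shows "part_series m {0, 1} = 1 + fps_X ^ m"
proof (rule fps_ext)
  fix i
  show "part_series m {0, 1} $ i = (1 + fps_X ^ m) $ i"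
    using assms by (auto simp: part_series_def fps_X_power_nth elim!: dvdE)
qed

lemma part_series_unrestricted:
  assumes "0 < m"
  shows "(1 - fps_X ^ m) * part_series m UNIV = 1"
proof (rule fps_ext)
  fix i
  have "((1 - fps_X ^ m) * part_series m UNIV) $ i =
      part_series m UNIV $ i - (if i < m then 0 else part_series m UNIV $ (i - m))"
    by (simp add: left_diff_distrib fps_X_power_mult_nth)
  also have "\<dots> = 1 $ i"
    using assms by (auto simp: part_series_def dvd_minus_self nat_dvd_not_less)
  finally show "((1 - fps_X ^ m) * part_series m UNIV) $ i = 1 $ i" .
qed

lemma partition_part_le:
  assumes "xs \<in> partitions n" "x \<in> set xs"
  shows "x \<le> n"
  using assms member_le_sum_list[of x xs] by (auto simp: partitions_def)

lemma distinct_iff_count_le_1: "distinct xs \<longleftrightarrow> (\<forall>x. count_list xs x \<in> {0, 1})"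
  by (induction xs) (auto simp: count_list_0_iff split: if_splits)

text \<open>
  The parts available in the product are the odd numbers below \<open>2N\<close> and the numbers \<open>4i+2\<close> with
  \<open>i < N\<close>. This set contains every number up to \<open>n\<close> that is not divisible by 4; its members
  beyond \<open>n\<close> cannot occur in a partition of \<open>n\<close>.
\<close>

lemma Q0_generating_function:
  assumes "n < 2 * N"
  shows "int (Q0 n) = ((\<Prod>i<N. 1 + fps_X ^ (2*i+1)) * (\<Prod>i<N. 1 + fps_X ^ (4*i+2))) $ n"
proof -
  define A B where "A = (\<lambda>i. 2*i+1) ` {..<N}" and "B = (\<lambda>i. 4*i+2) ` {..<N}"
  have AB: "m \<in> A \<union> B" if "m mod 4 \<noteq> 0" "m \<le> n" for m
  proof (cases "odd m")
    case True
    then obtain i where "m = 2*i+1" by (elim oddE)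
    then show ?thesis using that assms by (auto simp: A_def)
  next
    case False
    then have "m = 4 * (m div 4) + 2" using that by presburger
    moreover have "m div 4 < N" using that assms by linarith
    ultimately show ?thesis by (auto simp: B_def)
  qed
  have mod4: "m mod 4 \<noteq> 0" if "m \<in> A \<union> B" for m
    using that by (auto simp: A_def B_def) presburger+
  have "{xs \<in> partitions n. distinct xs \<and> (\<forall>x\<in>set xs. x mod 4 \<noteq> 0)} =
      restricted_partitions (A \<union> B) (\<lambda>m. {0, 1}) n" (is "?L = ?R")
  proof
    show "?L \<subseteq> ?R"
      using AB partition_part_le unfolding restricted_partitions_def distinct_iff_count_le_1 by blast
    show "?R \<subseteq> ?L"
    proof
      fix xs assume xs: "xs \<in> ?R"
      then have "count_list xs m \<in> {0, 1}" for m
        by (cases "m \<in> A \<union> B") (auto simp: restricted_partitions_def count_list_0_iff)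
      then show "xs \<in> ?L"
        using xs mod4 unfolding distinct_iff_count_le_1 restricted_partitions_def by blast
    qed
  qed
  then have "int (Q0 n) = (\<Prod>m\<in>A\<union>B. part_series m {0, 1}) $ n"
    using restricted_partitions_generating_function[of "A \<union> B" "\<lambda>m. {0, 1}" n]
    by (auto simp: Q0_def A_def B_def)
  also have "(\<Prod>m\<in>A\<union>B. part_series m {0, 1}) = (\<Prod>m\<in>A. part_series m {0, 1}) * (\<Prod>m\<in>B. part_series m {0, 1})"
  proof (rule prod.union_disjoint)
    show "A \<inter> B = {}" by (auto simp: A_def B_def) presburger
  qed (auto simp: A_def B_def)
  also have "(\<Prod>m\<in>A. part_series m {0, 1}) = (\<Prod>i<N. 1 + fps_X ^ (2*i+1))"
    unfolding A_def by (subst prod.reindex) (auto simp: inj_on_def part_series_at_most_once[simplified] simp del: power_Suc)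
  also have "(\<Prod>m\<in>B. part_series m {0, 1}) = (\<Prod>i<N. 1 + fps_X ^ (4*i+2))"
    unfolding B_def by (subst prod.reindex) (auto simp: inj_on_def part_series_at_most_once[simplified] simp del: power_Suc)
  finally show ?thesis .
qed

lemma pod_nat_generating_function:
  assumes "n < 2 * N"
  shows "int (pod_nat n) =
    ((\<Prod>i<N. 1 + fps_X ^ (2*i+1)) * (\<Prod>i<N. part_series (2*i+2) UNIV)) $ n"
proof -
  define A B where "A = (\<lambda>i. 2*i+1) ` {..<N}" and "B = (\<lambda>i. 2*i+2) ` {..<N}"
  define S where "S m = (if odd m then {0, 1} else UNIV :: nat set)" for m :: nat
  have AB: "m \<in> A \<union> B" if "0 < m" "m \<le> n" for m
  proof (cases "odd m")
    case True
    then obtain i where "m = 2*i+1" by (elim oddE)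
    then show ?thesis using that assms by (auto simp: A_def)
  next
    case False
    then have "m = 2 * (m div 2 - 1) + 2" using that by presburger
    moreover have "m div 2 - 1 < N" using that assms by linarith
    ultimately show ?thesis by (auto simp: B_def)
  qed
  have "count_list (filter odd xs) m \<in> {0, 1} \<longleftrightarrow> count_list xs m \<in> S m" for xs m
    by (simp add: count_list_filter S_def)
  then have distinct_odd: "distinct (filter odd xs) \<longleftrightarrow> (\<forall>m. count_list xs m \<in> S m)" for xs
    by (simp only: distinct_iff_count_le_1)
  have "{xs \<in> partitions n. distinct (filter odd xs)} = restricted_partitions (A \<union> B) S n"
    (is "?L = ?R")
  proof
    show "?L \<subseteq> ?R"
    proof
      fix xs assume xs: "xs \<in> ?L"
      then have "\<forall>m. count_list xs m \<in> S m"
        by (simp add: distinct_odd)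
      moreover have "set xs \<subseteq> A \<union> B"
      proof
        fix x assume x: "x \<in> set xs"
        have "0 < x" using xs x by (auto simp: partitions_def)
        moreover have "x \<le> n" using xs x by (intro partition_part_le) auto
        ultimately show "x \<in> A \<union> B" by (rule AB)
      qed
      ultimately show "xs \<in> ?R" using xs by (simp add: restricted_partitions_def)
    qed
    show "?R \<subseteq> ?L"
    proof
      fix xs assume xs: "xs \<in> ?R"
      have "count_list xs m \<in> S m" for m
      proof (cases "m \<in> A \<union> B")
        case False
        then have "m \<notin> set xs" using xs by (auto simp: restricted_partitions_def)
        then show ?thesis by (simp add: count_notin S_def)
      qed (use xs in \<open>auto simp: restricted_partitions_def\<close>)
      then show "xs \<in> ?L"
        using xs by (simp add: distinct_odd restricted_partitions_def)
    qed
  qed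
  then have "int (pod_nat n) = (\<Prod>m\<in>A\<union>B. part_series m (S m)) $ n"
    using restricted_partitions_generating_function[of "A \<union> B" S n]
    by (auto simp: pod_nat_def A_def B_def)
  also have "(\<Prod>m\<in>A\<union>B. part_series m (S m)) = (\<Prod>m\<in>A. part_series m (S m)) * (\<Prod>m\<in>B. part_series m (S m))"
  proof (rule prod.union_disjoint)
    show "A \<inter> B = {}" by (auto simp: A_def B_def) presburger
  qed (auto simp: A_def B_def)
  also have "(\<Prod>m\<in>A. part_series m (S m)) = (\<Prod>i<N. 1 + fps_X ^ (2*i+1))"
    unfolding A_def S_def
    by (subst prod.reindex) (auto simp: inj_on_def part_series_at_most_once[simplified] simp del: power_Suc)
  also have "(\<Prod>m\<in>B. part_series m (S m)) = (\<Prod>i<N. part_series (2*i+2) UNIV)"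
    unfolding B_def S_def by (subst prod.reindex) (auto simp: inj_on_def)
  finally show ?thesis .
qed

section \<open>Gauss's triangular number series\<close>

text \<open>
  Induction on \<open>n\<close>. Let \<open>\<rho> i\<close> be the \<open>i\<close>-th factor and \<open>R s\<close> the product of \<open>\<rho> i\<close> over
  \<open>s \<le> i < n\<close>, which is \<open>P\<^sub>n / P\<^sub>s\<close>. When \<open>n\<close> becomes \<open>n + 1\<close>, the \<open>s\<close>-th term on the right grows by

    \<open>R s q^(s(2n+1)) (q^(2n+1) (1 - q^(2s+1)) - (1 - q^(2s))) / (1 - q^(2n+1))\<close>,

  and this is \<open>V (s+1) - V s\<close> for \<open>V s = R s q^(s(2n+1)) (1 - q^(2s)) / (1 - q^(2n+1))\<close>, because
  \<open>R s (1 - q^(2s+1)) = R (s+1) (1 - q^(2s+2))\<close>. As \<open>V 0 = 0\<close>, the terms with \<open>s < n\<close> grow by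
  \<open>V n\<close> in total; together with the new term for \<open>s = n\<close> this gives the two new powers on the left.
\<close>

lemma shanks_identity:
  fixes q :: "'a::comm_ring_1" and u :: "nat \<Rightarrow> 'a"
  assumes u: "\<And>i. (1 - q ^ (2*i+1)) * u i = 1"
  shows "(\<Sum>k<2*n. q ^ (\<Sum>{..k})) =
    (\<Sum>s<n. q ^ (s * (2*n+1)) * (\<Prod>i=s..<n. (1 - q ^ (2*i+2)) * u i))"
proof (induction n)
  case (Suc n)
  define \<rho> where "\<rho> i = (1 - q ^ (2*i+2)) * u i" for i
  define R where "R s = (\<Prod>i=s..<n. \<rho> i)" for s
  define V where "V s = u n * (1 - q ^ (2*s)) * q ^ (s * (2*n+1)) * R s" for s
  have tri: "2 * (\<Sum>{..k}) = k * (k + 1)" for k :: nat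
    by (induction k) auto
  have tri_even: "\<Sum>{..2*n} = n * (2*n+1)"
    using tri[of "2*n"] by simp
  have tri_odd: "\<Sum>{..Suc (2*n)} = (n + 1) * (2*n+1)"
    using tri[of "Suc (2*n)"] by (simp add: algebra_simps)
  have shift: "\<rho> s * (1 - q ^ (2*s+1)) = 1 - q ^ (2*s+2)" for s
    using u[of s] unfolding \<rho>_def by (metis mult.assoc mult.commute mult.right_neutral)
  have telescope: "q ^ (s * (2 * Suc n+1)) * (\<Prod>i=s..<Suc n. \<rho> i) - q ^ (s * (2*n+1)) * R s
     = V (Suc s) - V s" if "s < n" for s
  proof -
    have R: "R s = \<rho> s * R (Suc s)"
      using that by (simp add: R_def prod.atLeast_Suc_lessThan)
    have V': "V (Suc s) = u n * q ^ (2*n+1) * (1 - q ^ (2*s+1)) * q ^ (s * (2*n+1)) * R s"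
    proof -
      have "V (Suc s) = u n * (1 - q ^ (2*s+2)) * q ^ (2*n+1) * q ^ (s * (2*n+1)) * R (Suc s)"
        unfolding V_def by (simp add: power_add algebra_simps)
      then show ?thesis by (simp only: R shift[symmetric]) (simp add: mult_ac)
    qed
    have "q ^ (s * (2 * Suc n+1)) * (\<Prod>i=s..<Suc n. \<rho> i) =
        q ^ (2*s) * q ^ (s * (2*n+1)) * R s * (1 - q ^ (2*n+2)) * u n"
      using that by (simp add: R_def \<rho>_def power_add[symmetric] algebra_simps)
    moreover have "q ^ (2*n+2) = q * q ^ (2*n+1)" "q ^ (2*s+1) = q * q ^ (2*s)" by simp_all
    \<comment> \<open>For \<open>c = q^(2n+1)\<close> and \<open>v = u n\<close> the factor \<open>(1 - c) v\<close> is 1; it gives both terms the denominator \<open>1 - c\<close>.\<close>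
    moreover have "a * w * x * (1 - q * c) * v - (1 - c) * v * (w * x) =
        v * c * (1 - q * a) * w * x - v * (1 - a) * w * x" for a c v w x :: 'a
      by (simp add: algebra_simps)
    from this[of "q ^ (2*s)" "q ^ (s * (2*n+1))" "R s" "q ^ (2*n+1)" "u n"]
    have "q ^ (2*s) * q ^ (s * (2*n+1)) * R s * (1 - q * q ^ (2*n+1)) * u n - q ^ (s * (2*n+1)) * R s
       = u n * q ^ (2*n+1) * (1 - q * q ^ (2*s)) * q ^ (s * (2*n+1)) * R s
         - u n * (1 - q ^ (2*s)) * q ^ (s * (2*n+1)) * R s"
      by (simp only: u mult_1_left)
    ultimately show ?thesis unfolding V' by (simp only: V_def)
  qed
  have "(\<Sum>s<n. q ^ (s * (2 * Suc n+1)) * (\<Prod>i=s..<Suc n. \<rho> i)) - (\<Sum>s<n. q ^ (s * (2*n+1)) * R s)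
      = (\<Sum>s<n. V (Suc s) - V s)"
    unfolding sum_subtractf[symmetric] by (intro sum.cong refl telescope) simp
  also have "\<dots> = V n - V 0" by (rule sum_lessThan_telescope)
  also have "\<dots> = u n * (1 - q ^ (2*n)) * q ^ (n * (2*n+1))" by (simp add: V_def R_def)
  finally have front: "(\<Sum>s<n. q ^ (s * (2 * Suc n+1)) * (\<Prod>i=s..<Suc n. \<rho> i)) =
      (\<Sum>s<n. q ^ (s * (2*n+1)) * R s) + u n * (1 - q ^ (2*n)) * q ^ (n * (2*n+1))"
    by (simp only: diff_eq_eq add.commute)
  have last: "q ^ (n * (2 * Suc n+1)) * (\<Prod>i=n..<Suc n. \<rho> i) =
      u n * q ^ (n * (2*n+1)) * (q ^ (2*n) * (1 - q ^ (2*n+2)))"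
  proof -
    have "n * (2 * Suc n+1) = n * (2*n+1) + 2*n" by simp
    then show ?thesis by (simp only: \<rho>_def power_add) (simp add: mult_ac)
  qed
  have "(\<Sum>s<Suc n. q ^ (s * (2 * Suc n+1)) * (\<Prod>i=s..<Suc n. \<rho> i))
      = (\<Sum>s<n. q ^ (s * (2*n+1)) * R s)
        + u n * q ^ (n * (2*n+1)) * ((1 - q ^ (2*n)) + q ^ (2*n) * (1 - q ^ (2*n+2)))"
    unfolding sum.lessThan_Suc front last by (simp only: distrib_left mult_ac add.assoc)
  also have "(1 - q ^ (2*n)) + q ^ (2*n) * (1 - q ^ (2*n+2)) = (1 - q ^ (2*n+1)) * (1 + q ^ (2*n+1))"
    by (simp add: power_add algebra_simps)
  also have "u n * q ^ (n * (2*n+1)) * \<dots> =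
      ((1 - q ^ (2*n+1)) * u n) * (q ^ (n * (2*n+1)) * (1 + q ^ (2*n+1)))"
    by (simp only: mult_ac)
  also have "\<dots> = q ^ (\<Sum>{..2*n}) + q ^ (\<Sum>{..Suc (2*n)})"
  proof -
    have "(n + 1) * (2*n+1) = n * (2*n+1) + (2*n+1)" by simp
    then show ?thesis unfolding u tri_even tri_odd by (simp only: power_add distrib_left mult_1_left mult_1_right)
  qed
  finally show ?case
    using Suc by (simp add: \<rho>_def R_def add.assoc)
qed simp

lemma dvd_prod_minus_1:
  fixes f :: "'b \<Rightarrow> 'a::comm_ring_1"
  assumes "finite A" "\<And>i. i \<in> A \<Longrightarrow> c dvd f i - 1"
  shows "c dvd prod f A - 1"
  using assms
proof (induction A)
  case (insert a A)
  have "prod f (insert a A) - 1 = (f a - 1) * prod f A + (prod f A - 1)"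
    using insert by (simp add: algebra_simps)
  moreover have "c dvd f a - 1" "c dvd prod f A - 1" using insert by auto
  ultimately show ?case by (simp only: dvd_add dvd_mult2)
qed simp

text \<open>
  In Shanks's identity the term for \<open>s = 0\<close> is the quotient of the two products, and every other
  term contains the factor \<open>q^(2N+1)\<close>.
\<close>

lemma gauss_triangular_series_truncated:
  fixes q :: "'a::comm_ring_1" and u :: "nat \<Rightarrow> 'a"
  assumes u: "\<And>i. (1 - q ^ (2*i+1)) * u i = 1"
  shows "q ^ (2*N) dvd (\<Sum>k<2*N. q ^ (\<Sum>{..k})) * (\<Prod>i<N. 1 - q ^ (2*i+1)) - (\<Prod>i<N. 1 - q ^ (2*i+2))"
proof (cases "N = 0")
  case False
  define T where "T s = q ^ (s * (2*N+1)) * (\<Prod>i=s..<N. (1 - q ^ (2*i+2)) * u i)" for s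
  have "{..<N} = insert 0 {1..<N}" using False by auto
  then have "(\<Sum>k<2*N. q ^ (\<Sum>{..k})) = T 0 + (\<Sum>s=1..<N. T s)"
    by (simp add: shanks_identity[OF u] T_def)
  moreover have "T 0 * (\<Prod>i<N. 1 - q ^ (2*i+1)) = (\<Prod>i<N. (1 - q ^ (2*i+2)) * ((1 - q ^ (2*i+1)) * u i))"
    by (simp add: T_def prod.distrib atLeast0LessThan mult_ac)
  moreover have "q ^ (2*N) dvd (\<Sum>s=1..<N. T s)"
  proof (rule dvd_sum)
    fix s assume "s \<in> {1..<N}"
    then have "2*N \<le> s * (2*N+1)" by (cases s) auto
    then show "q ^ (2*N) dvd T s" unfolding T_def by (intro dvd_mult2 le_imp_power_dvd)
  qed
  ultimately show ?thesis by (simp only: u) (simp add: distrib_right)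
qed simp

lemma prod_odd_even_split:
  fixes f :: "nat \<Rightarrow> 'a::comm_monoid_mult"
  shows "(\<Prod>i<2*N. f i) = (\<Prod>i<N. f (2*i) * f (2*i+1))"
  by (induction N) (simp_all add: mult_ac)

text \<open>
  Let \<open>P\<close>, \<open>E\<close>, \<open>U\<close>, \<open>V\<close>, \<open>D\<close> be the products of \<open>1 + q^(2i+1)\<close>, \<open>1 + q^(4i+2)\<close>, \<open>1 - q^(2i+1)\<close>,
  \<open>1 - q^(2i+2)\<close>, \<open>1 - q^(4i+4)\<close> for \<open>i < N\<close>. Then \<open>P U D\<close> is the product of \<open>1 - q^(2i+2)\<close> for
  \<open>i < 2N\<close>, which agrees with \<open>V\<close> modulo \<open>q^(2N)\<close>, and so does \<open>\<psi> U\<close> by Gauss. Multiplying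
  \<open>P U D \<equiv> \<psi> U\<close> by \<open>E\<close> and by the inverses of \<open>U\<close> and \<open>D\<close> gives \<open>P E \<equiv> \<psi> E / D\<close>.
\<close>

lemma Q0_product_congruence:
  fixes q :: "'a::comm_ring_1" and u d :: "nat \<Rightarrow> 'a"
  assumes u: "\<And>i. (1 - q ^ (2*i+1)) * u i = 1"
    and d: "\<And>i. (1 - q ^ (4*i+4)) * d i = 1"
  shows "q ^ (2*N) dvd (\<Prod>i<N. 1 + q ^ (2*i+1)) * (\<Prod>i<N. 1 + q ^ (4*i+2))
     - (\<Sum>k<2*N. q ^ (\<Sum>{..k})) * ((\<Prod>i<N. 1 + q ^ (4*i+2)) * (\<Prod>i<N. d i))"
proof -
  define \<psi> where "\<psi> = (\<Sum>k<2*N. q ^ (\<Sum>{..k}))"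
  define P where "P = (\<Prod>i<N. 1 + q ^ (2*i+1))"
  define E where "E = (\<Prod>i<N. 1 + q ^ (4*i+2))"
  define U where "U = (\<Prod>i<N. 1 - q ^ (2*i+1))"
  define V where "V = (\<Prod>i<N. 1 - q ^ (2*i+2))"
  define W where "W = (\<Prod>i=N..<2*N. 1 - q ^ (2*i+2))"
  define D where "D = (\<Prod>i<N. 1 - q ^ (4*i+4))"
  have inverses: "U * prod u {..<N} = 1" "D * prod d {..<N} = 1"
    by (simp_all only: U_def D_def prod.distrib[symmetric] u d prod.neutral_const)
  have "P * U * D = (\<Prod>i<N. (1 - q ^ (2*(2*i)+2)) * (1 - q ^ (2*(2*i+1)+2)))"
    unfolding P_def U_def D_def prod.distrib[symmetric]
  proof (intro prod.cong refl)
    fix i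
    have "(1 + q ^ (2*i+1)) * (1 - q ^ (2*i+1)) = 1 - q ^ (2*(2*i)+2)"
      by (simp add: algebra_simps power_add[symmetric] mult_2)
    moreover have "2*(2*i+1)+2 = 4*i+4" by simp
    ultimately show "(1 + q ^ (2*i+1)) * (1 - q ^ (2*i+1)) * (1 - q ^ (4*i+4)) =
        (1 - q ^ (2*(2*i)+2)) * (1 - q ^ (2*(2*i+1)+2))"
      by (simp only:)
  qed
  also have "\<dots> = (\<Prod>i<2*N. 1 - q ^ (2*i+2))"
    by (rule prod_odd_even_split[symmetric])
  also have "\<dots> = V * W"
    unfolding V_def W_def using prod.atLeastLessThan_concat[of 0 N "2*N" "\<lambda>i. 1 - q ^ (2*i+2)"]
    by (simp add: atLeast0LessThan)
  finally have "P * U * D - V = V * (W - 1)" by (simp add: algebra_simps)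
  moreover have "q ^ (2*N) dvd W - 1"
    unfolding W_def by (rule dvd_prod_minus_1) (auto intro!: le_imp_power_dvd simp del: power_Suc)
  ultimately have "q ^ (2*N) dvd P * U * D - V" by simp
  moreover have "q ^ (2*N) dvd \<psi> * U - V"
    unfolding \<psi>_def U_def V_def using u by (rule gauss_triangular_series_truncated)
  ultimately have "q ^ (2*N) dvd (P * U * D - V) - (\<psi> * U - V)" by (rule dvd_diff)
  then have "q ^ (2*N) dvd (P * U * D - \<psi> * U) * (E * prod d {..<N} * prod u {..<N})"
    by (intro dvd_mult2) simp
  also have "\<dots> = P * E * (U * prod u {..<N}) * (D * prod d {..<N}) - \<psi> * (E * prod d {..<N}) * (U * prod u {..<N})"
    by (simp add: left_diff_distrib right_diff_distrib mult_ac)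
  finally show ?thesis
    unfolding inverses by (simp add: \<psi>_def P_def E_def)
qed

section \<open>Comparison of coefficients\<close>

lemma pod_argument:
  "pod ((of_nat n - of_nat k * (of_nat k + 1) / 2) / 2) =
    (if \<Sum>{..k} \<le> n \<and> even (n - \<Sum>{..k}) then pod_nat ((n - \<Sum>{..k}) div 2) else 0)"
proof -
  define t where "t = \<Sum>{..k}"
  define x :: rat where "x = (of_nat n - of_nat k * (of_nat k + 1) / 2) / 2"
  have "2 * t = k * (k + 1)" unfolding t_def by (induction k) auto
  then have "2 * (of_nat t :: rat) = of_nat k * (of_nat k + 1)"
    by (metis of_nat_1 of_nat_add of_nat_mult of_nat_numeral)
  then have x: "x = (of_nat n - of_nat t) / 2" unfolding x_def by (simp add: field_simps)
  have whole: "x = of_nat m \<longleftrightarrow> n = t + 2 * m" for m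
  proof -
    have "x = of_nat m \<longleftrightarrow> (of_nat n :: rat) = of_nat (t + 2 * m)"
      unfolding x by (auto simp: field_simps)
    then show ?thesis by (simp only: of_nat_eq_iff)
  qed
  show ?thesis
  proof (cases "t \<le> n \<and> even (n - t)")
    case True
    then have "x = of_nat ((n - t) div 2)" unfolding whole by auto
    then have "pod x = pod_nat ((n - t) div 2)" by (simp add: pod_def)
    then show ?thesis using True unfolding x_def[symmetric] t_def[symmetric] by presburger
  next
    case False
    then have "x \<notin> \<nat>" by (auto simp: whole elim!: Nats_cases)
    then show ?thesis using False unfolding x_def[symmetric] t_def[symmetric] by (auto simp: pod_def)
  qed
qed

text \<open>
  Substituting \<open>q^2\<close> for \<open>q\<close> accounts for the halved argument of \<open>pod\<close>.
\<close>

lemma part_series_compose_square: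
  assumes "0 < m"
  shows "(1 - fps_X ^ (2*m)) * (part_series m UNIV oo fps_X ^ 2) = 1"
proof -
  have "((1 - fps_X ^ m) * part_series m UNIV) oo (fps_X ^ 2 :: int fps) = 1"
    using assms by (simp add: part_series_unrestricted)
  then show ?thesis
    by (simp add: fps_compose_mult_distrib fps_compose_sub_distrib fps_X_power_compose power_mult)
qed

theorem theorem6p1:
  fixes n :: nat
  shows "(\<lambda>k::nat. pod ((of_nat n - of_nat k * (of_nat k + 1) / 2) / 2)) sums Q0 n"
proof -
  \<comment> \<open>Large enough that \<open>n < 2N\<close>, and that all \<open>k\<close> with \<open>t k \<le> n\<close> lie below \<open>2N\<close>.\<close>
  define N where "N = Suc n"
  define t :: "nat \<Rightarrow> nat" where "t k = \<Sum>{..k}" for k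
  define f where "f k = (if t k \<le> n \<and> even (n - t k) then pod_nat ((n - t k) div 2) else 0)" for k
  define q :: "int fps" where "q = fps_X"
  define d where "d i = part_series (2*i+2) UNIV oo q ^ 2" for i
  define F where "F = (\<Prod>i<N. 1 + q ^ (2*i+1)) * (\<Prod>i<N. part_series (2*i+2) UNIV)"
  define G where "G = (\<Prod>i<N. 1 + q ^ (4*i+2)) * (\<Prod>i<N. d i)"
  have G: "G = F oo q ^ 2"
    by (simp add: F_def G_def d_def q_def fps_compose_mult_distrib fps_compose_prod_distrib
        fps_compose_add_distrib fps_X_power_compose power_mult[symmetric] algebra_simps
        del: power_Suc)
  have coeff: "G $ m = (if even m then int (pod_nat (m div 2)) else 0)" if "m \<le> n" for m
    using pod_nat_generating_function[of "m div 2" N] that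
    by (simp add: G F_def q_def fps_nth_compose_X_power N_def)
  have "q ^ (2*N) dvd (\<Prod>i<N. 1 + q ^ (2*i+1)) * (\<Prod>i<N. 1 + q ^ (4*i+2)) - (\<Sum>k<2*N. q ^ t k) * G"
    unfolding G_def t_def
  proof (rule Q0_product_congruence)
    fix i
    show "(1 - q ^ (2*i+1)) * part_series (2*i+1) UNIV = 1"
      unfolding q_def by (rule part_series_unrestricted) simp
    show "(1 - q ^ (4*i+4)) * d i = 1"
      unfolding q_def d_def using part_series_compose_square[of "2*i+2"]
      by (simp only: distrib_left) simp
  qed
  then have "((\<Prod>i<N. 1 + q ^ (2*i+1)) * (\<Prod>i<N. 1 + q ^ (4*i+2)) - (\<Sum>k<2*N. q ^ t k) * G) $ n = 0"
    by (elim dvdE) (simp add: q_def N_def fps_X_power_mult_nth del: power_Suc fps_sub_nth)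
  then have "int (Q0 n) = ((\<Sum>k<2*N. q ^ t k) * G) $ n"
    using Q0_generating_function[of n N] by (simp add: q_def N_def)
  also have "\<dots> = (\<Sum>k<2*N. if t k \<le> n then G $ (n - t k) else 0)"
    by (simp add: sum_distrib_right fps_sum_nth q_def fps_X_power_mult_nth if_distrib cong: if_cong)
       (auto intro!: sum.cong)
  also have "\<dots> = int (\<Sum>k<2*N. f k)"
    by (auto simp: f_def coeff intro!: sum.cong)
  finally have "Q0 n = (\<Sum>k<2*N. f k)" by (simp only: of_nat_eq_iff)
  moreover have "f k = 0" if "k \<notin> {..<2*N}" for k
  proof -
    have "k \<le> t k" unfolding t_def by (induction k) auto
    then show ?thesis using that by (simp add: f_def N_def)
  qed
  ultimately have "f sums Q0 n" using sums_finite[of "{..<2*N}" f] by simp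
  moreover have "f = (\<lambda>k. pod ((of_nat n - of_nat k * (of_nat k + 1) / 2) / 2))"
    by (rule ext) (simp only: pod_argument f_def t_def)
  ultimately show ?thesis by (simp only:)
qed

end
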